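(* Let $\mathbf{\pi}=(\pi(j))_{j\ge1}$ be a probability distribution on $\mathbb{N}=\{1,2,\dots\}$ with $\pi(j)>0$ for all $j\geq 1$, the law of a random variable $X_\infty$, with $F_\infty(j)=\sum_{k=1}^j\pi(k)$ and $\Phi_\infty(z)=\sum_{j\ge1}\pi(j)z^j$, $z\in[0,1]$. Let $\nu$ be the $\mathbb{N}$-valued random variable whose distribution function $F(j)=\mathbf{P}(\nu\le j)$ is determined by $F_\infty(j)=\Phi_\infty(F(j))$, $j\ge1$. Then the mapping $X_\infty\to\nu$ (law of $X_\infty$ to law of $\nu$) is one-to-one. Moreover, setting $C_{n-1,0}=\delta_{n-1,0}$, $$C_{n-1,k}=\sum{}^{*}\prod_{m\ge1}\frac{\left(\pi(m+1)/\pi(1)\right)^{k_m}}{k_m!},$$ where the sum $\sum^*$ runs over integers $k_m\ge0$ with $\sum_{m\ge1}k_m=k$ and $\sum_{m\ge1}m k_m=n-1$, and $$h_1=1,\qquad h_n=\frac1n\sum_{k=1}^{n-1}(-1)^k[n]_k\,C_{n-1,k}\quad(n\ge2),$$ the cumulated mass function of $\nu$ corresponding to the given $\mathbf{\pi}$ is $$F(j)=\Phi_\infty^{-1}(F_\infty(j))=\sum_{n\ge1}h_n\left(F_\infty(j)/\pi(1)\right)^n .$$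
   Context: $[n]_k=n(n+1)\cdots(n+k-1)$ denotes the rising factorial; $\delta_{a,b}$ is the Kronecker symbol. $\Phi_\infty^{-1}$ is the inverse of the increasing map $\Phi_\infty:[0,1]\to[0,1]$, and the series in powers of $F_\infty(j)$ is its Lagrange-inversion power series, with coefficients $[z^n]\Phi_\infty^{-1}(z)=h_n\pi(1)^{-n}$. The functional equation $F_\infty(j)=\Phi_\infty(F(j))$ expresses that $\mathbf{\pi}$ is an invariant probability measure of the Lamperti maximal branching process $X_{n+1}=\max_{j=1,\dots,X_n}\nu_{j,n+1}$ ($\nu_{j,n+1}$ i.i.d. copies of $\nu$), which is the Markov chain on $\mathbb{N}$ with transition matrix $P(i,j)=F(j)^i-F(j-1)^i$, $F(0)=0$.
   Formalization: The series formula for F(j) is asserted only for those j at which the series converges; it can diverge (e.g. geometric π with p = 0.2, j = 2). The coefficient identity for the inverse of Φ_∞ and its convergence near 0 hold unconditionally. *)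

theory Defs
  imports "HOL-Probability.Probability" "HOL-Computational_Algebra.Formal_Power_Series"
begin

text \<open>Laws on the positive integers are represented as \<^typ>\<open>nat pmf\<close> whose support avoids 0.\<close>

definition full_support_laws :: "nat pmf set" where
  "full_support_laws = {\<pi>. set_pmf \<pi> = {1..}}"

definition F_inf :: "nat pmf \<Rightarrow> nat \<Rightarrow> real" where
  "F_inf \<pi> j = (\<Sum>k = 1..j. pmf \<pi> k)"

definition Phi_inf :: "nat pmf \<Rightarrow> real \<Rightarrow> real" where
  "Phi_inf \<pi> z = (\<Sum>j. pmf \<pi> (Suc j) * z ^ Suc j)"

definition Phi_inf_inv :: "nat pmf \<Rightarrow> real \<Rightarrow> real" where
  "Phi_inf_inv \<pi> = inv_into {0..1} (Phi_inf \<pi>)"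

abbreviation distr_fun :: "nat pmf \<Rightarrow> nat \<Rightarrow> real" where
  "distr_fun \<nu> j \<equiv> measure_pmf.prob \<nu> {..j}"

definition is_nu_law :: "nat pmf \<Rightarrow> nat pmf \<Rightarrow> bool" where
  "is_nu_law \<pi> \<nu> \<longleftrightarrow>
     set_pmf \<nu> \<subseteq> {1..} \<and> (\<forall>j\<ge>1. F_inf \<pi> j = Phi_inf \<pi> (distr_fun \<nu> j))"

definition nu_law :: "nat pmf \<Rightarrow> nat pmf" where
  "nu_law \<pi> = (THE \<nu>. is_nu_law \<pi> \<nu>)"

text \<open>Families \<open>(k\<^sub>m)\<close>, \<open>m \<ge> 1\<close>, with \<open>\<Sum> k\<^sub>m = k\<close> and \<open>\<Sum> m k\<^sub>m = N\<close>, encoded as functions on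
  \<^typ>\<open>nat\<close> vanishing at 0. Finite support is explicit because \<^const>\<open>sum\<close> is 0 over infinite sets.\<close>

definition star_families :: "nat \<Rightarrow> nat \<Rightarrow> (nat \<Rightarrow> nat) set" where
  "star_families N k =
     {\<kappa>. \<kappa> 0 = 0 \<and> finite {m. \<kappa> m \<noteq> 0} \<and>
          (\<Sum>m | \<kappa> m \<noteq> 0. \<kappa> m) = k \<and> (\<Sum>m | \<kappa> m \<noteq> 0. m * \<kappa> m) = N}"

lemma finite_star_families: "finite (star_families N k)"
proof -
  have "star_families N k \<subseteq> {\<kappa>. \<forall>m. (m \<in> {..N} \<longrightarrow> \<kappa> m \<in> {..N}) \<and> (m \<notin> {..N} \<longrightarrow> \<kappa> m = 0)}"
  proof (intro subsetI CollectI allI)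
    fix \<kappa> m assume \<kappa>: "\<kappa> \<in> star_families N k"
    show "(m \<in> {..N} \<longrightarrow> \<kappa> m \<in> {..N}) \<and> (m \<notin> {..N} \<longrightarrow> \<kappa> m = 0)"
    proof (cases "\<kappa> m = 0")
      case False
      with \<kappa> have "m \<ge> 1" by (cases m) (auto simp: star_families_def)
      have "m * \<kappa> m \<le> (\<Sum>m | \<kappa> m \<noteq> 0. m * \<kappa> m)"
        using \<kappa> False by (intro member_le_sum) (auto simp: star_families_def)
      also have "\<dots> = N" using \<kappa> by (simp add: star_families_def)
      finally have *: "m * \<kappa> m \<le> N" .
      have "m * 1 \<le> m * \<kappa> m"
        using False by (intro mult_le_mono) auto
      moreover have "1 * \<kappa> m \<le> m * \<kappa> m"
        using \<open>m \<ge> 1\<close> by (intro mult_le_mono) auto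
      ultimately have "m \<le> N" "\<kappa> m \<le> N"
        using * by linarith+
      then show ?thesis by simp
    qed simp
  qed
  moreover have "finite \<dots>" by (rule finite_set_of_finite_funs) auto
  ultimately show ?thesis by (rule finite_subset)
qed

definition C_coeff :: "nat pmf \<Rightarrow> nat \<Rightarrow> nat \<Rightarrow> real" where
  "C_coeff \<pi> N k =
     (if k = 0 then (if N = 0 then 1 else 0)
      else \<Sum>\<kappa>\<in>star_families N k. \<Prod>m | \<kappa> m \<noteq> 0. (pmf \<pi> (m + 1) / pmf \<pi> 1) ^ \<kappa> m / fact (\<kappa> m))"

definition h_coeff :: "nat pmf \<Rightarrow> nat \<Rightarrow> real" where
  "h_coeff \<pi> n =
     (if n = 1 then 1
      else 1 / real n * (\<Sum>k = 1..n - 1. (-1) ^ k * pochhammer (real n) k * C_coeff \<pi> (n - 1) k))"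

text \<open>The series of Lagrange terms need not converge at every value of \<^const>\<open>F_inf\<close>: for
  \<open>\<pi> j = p (1 - p) ^ (j - 1)\<close> its radius of convergence is \<open>p / (1 - p)\<close>, which is less than 1 if
  \<open>p < 1 / 2\<close>.\<close>

definition Lagrange_term :: "nat pmf \<Rightarrow> real \<Rightarrow> nat \<Rightarrow> real" where
  "Lagrange_term \<pi> w n = h_coeff \<pi> n * (w / pmf \<pi> 1) ^ n"

end

theory Submission
  imports Defs "HOL-Complex_Analysis.Complex_Analysis"
    "HOL-Computational_Algebra.Formal_Laurent_Series"
begin

text \<open>\<open>\<Phi>\<^sub>\<infinity>\<close> is a continuous increasing bijection of \<open>[0, 1]\<close>, so \<open>F = \<Phi>\<^sub>\<infinity>\<inverse> \<circ> F\<^sub>\<infinity>\<close> is the distribution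
  function of a unique law \<open>\<nu>\<close>. The equation \<open>F\<^sub>\<infinity> = \<Phi>\<^sub>\<infinity> \<circ> F\<close> says that \<open>\<pi>\<close> is invariant for the
  transition matrix \<open>F j ^ i - F (j - 1) ^ i\<close>, whose entries are positive for \<open>i, j \<ge> 1\<close>; such a matrix has
  at most one invariant probability, so \<open>\<nu>\<close> determines \<open>\<pi>\<close>. The coefficients \<open>h n\<close> come from Lagrange
  inversion, with \<open>(1 + u) ^ -n\<close> expanded by the binomial series and the powers of \<open>u\<close> by the
  multinomial formula.\<close>

subsection \<open>Coefficients of powers of a power series\<close>

text \<open>The summand of \<open>C_coeff\<close> for a general sequence \<open>a\<close>; times
  \<open>fact k\<close> it is a multinomial coefficient times a monomial in the
  \<open>a m\<close>.\<close>

definition family_weight :: "(nat \<Rightarrow> 'a :: field_char_0) \<Rightarrow> (nat \<Rightarrow> nat) \<Rightarrow> 'a" where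
  "family_weight a \<kappa> = (\<Prod>m | \<kappa> m \<noteq> 0. a m ^ \<kappa> m / fact (\<kappa> m))"

lemma star_familiesD_support:
  assumes "\<kappa> \<in> star_families N k" and "\<kappa> m \<noteq> 0"
  shows "1 \<le> m \<and> m \<le> N"
proof -
  from assms have "m \<noteq> 0" by (auto simp: star_families_def intro!: gr0I)
  have "m * \<kappa> m \<le> (\<Sum>m | \<kappa> m \<noteq> 0. m * \<kappa> m)"
    using assms by (intro member_le_sum) (auto simp: star_families_def)
  then have "m * \<kappa> m \<le> N" using assms by (simp add: star_families_def)
  moreover have "m * 1 \<le> m * \<kappa> m" using assms by (intro mult_le_mono) auto
  ultimately show ?thesis using \<open>m \<noteq> 0\<close> by linarith
qed

text \<open>Replaces the support, which varies with \<open>\<kappa>\<close>, by one range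
  \<open>{1..M}\<close> common to all families, so that sums can be interchanged and single entries
  changed.\<close>

lemma star_families_iff:
  assumes "N \<le> M"
  shows "\<kappa> \<in> star_families N k \<longleftrightarrow>
    (\<forall>m. m \<notin> {1..M} \<longrightarrow> \<kappa> m = 0) \<and> (\<Sum>m=1..M. \<kappa> m) = k \<and> (\<Sum>m=1..M. m * \<kappa> m) = N"
    (is "?L \<longleftrightarrow> ?R")
proof -
  have sub: "{m. \<kappa> m \<noteq> 0} \<subseteq> {1..M} \<longleftrightarrow> (\<forall>m. m \<notin> {1..M} \<longrightarrow> \<kappa> m = 0)"
    by (simp only: subset_iff mem_Collect_eq) metis
  have eq: "(\<Sum>m | \<kappa> m \<noteq> 0. \<kappa> m) = (\<Sum>m=1..M. \<kappa> m)"
      "(\<Sum>m | \<kappa> m \<noteq> 0. m * \<kappa> m) = (\<Sum>m=1..M. m * \<kappa> m)" if "{m. \<kappa> m \<noteq> 0} \<subseteq> {1..M}"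
    using that by (auto intro: sum.mono_neutral_left)
  show ?thesis
  proof
    assume L: ?L
    have s: "{m. \<kappa> m \<noteq> 0} \<subseteq> {1..M}"
    proof
      fix m assume "m \<in> {m. \<kappa> m \<noteq> 0}"
      then show "m \<in> {1..M}" using star_familiesD_support[OF L, of m] assms by simp
    qed
    then show ?R using L eq[OF s] sub unfolding star_families_def by simp
  next
    assume R: ?R
    then have s: "{m. \<kappa> m \<noteq> 0} \<subseteq> {1..M}" using sub by blast
    then have "\<kappa> 0 = 0" "finite {m. \<kappa> m \<noteq> 0}" using finite_subset by auto
    then show ?L using eq[OF s] R unfolding star_families_def by simp
  qed
qed

lemma family_weight_eq_prod:
  assumes "\<kappa> \<in> star_families N k" and "N \<le> M"
  shows "family_weight a \<kappa> = (\<Prod>m=1..M. a m ^ \<kappa> m / fact (\<kappa> m))"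
  unfolding family_weight_def
proof (rule prod.mono_neutral_left)
  show "{m. \<kappa> m \<noteq> 0} \<subseteq> {1..M}"
  proof
    fix m assume "m \<in> {m. \<kappa> m \<noteq> 0}"
    then show "m \<in> {1..M}" using star_familiesD_support[OF assms(1), of m] assms(2) by simp
  qed
qed auto

text \<open>Raising the entry at \<open>m\<close> by 1 adds 1 to the total and \<open>m\<close> to
  the weighted total; lowering a nonzero entry by 1 undoes this.\<close>

lemma star_families_Suc_pos_bij:
  assumes m: "1 \<le> m" "m \<le> N"
  shows "bij_betw (\<lambda>\<kappa>. \<kappa>(m := Suc (\<kappa> m))) (star_families (N - m) k)
           {\<kappa> \<in> star_families N (Suc k). \<kappa> m \<noteq> 0}"
proof (rule bij_betw_byWitness[where f' = "\<lambda>\<kappa>. \<kappa>(m := \<kappa> m - 1)"])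
  \<comment> \<open>The range \<open>{1..N}\<close> serves both weights: \<open>m\<close> may exceed
    \<open>N - m\<close>, and the smaller range would then miss it.\<close>
  have mA: "m \<in> {1..N}" using m by simp
  have sums: "(\<Sum>i=1..N. f i) = f m + (\<Sum>i\<in>{1..N} - {m}. f i)" for f :: "nat \<Rightarrow> nat"
    using mA by (simp add: sum.remove)
  have upd: "(\<Sum>i\<in>{1..N} - {m}. (\<kappa>(m := x)) i) = (\<Sum>i\<in>{1..N} - {m}. \<kappa> i)"
      "(\<Sum>i\<in>{1..N} - {m}. i * (\<kappa>(m := x)) i) = (\<Sum>i\<in>{1..N} - {m}. i * \<kappa> i)" for \<kappa> :: "nat \<Rightarrow> nat" and x
    by (auto intro!: sum.cong)
  show "(\<lambda>\<kappa>. \<kappa>(m := Suc (\<kappa> m))) ` star_families (N - m) k \<subseteq> {\<kappa> \<in> star_families N (Suc k). \<kappa> m \<noteq> 0}"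
  proof (intro image_subsetI CollectI conjI)
    fix \<kappa> assume "\<kappa> \<in> star_families (N - m) k"
    then have h: "\<forall>i. i \<notin> {1..N} \<longrightarrow> \<kappa> i = 0" "(\<Sum>i=1..N. \<kappa> i) = k" "(\<Sum>i=1..N. i * \<kappa> i) = N - m"
      by (subst (asm) star_families_iff[of _ N]; simp)+
    show "\<kappa>(m := Suc (\<kappa> m)) \<in> star_families N (Suc k)"
      unfolding star_families_iff[OF order_refl] sums upd
      using h[unfolded sums] m by auto
  qed simp
  show "(\<lambda>\<kappa>. \<kappa>(m := \<kappa> m - 1)) ` {\<kappa> \<in> star_families N (Suc k). \<kappa> m \<noteq> 0} \<subseteq> star_families (N - m) k"
  proof (intro image_subsetI)
    fix \<kappa> assume *: "\<kappa> \<in> {\<kappa> \<in> star_families N (Suc k). \<kappa> m \<noteq> 0}"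
    then have h: "\<forall>i. i \<notin> {1..N} \<longrightarrow> \<kappa> i = 0" "(\<Sum>i=1..N. \<kappa> i) = Suc k" "(\<Sum>i=1..N. i * \<kappa> i) = N"
      unfolding star_families_iff[OF order_refl] by auto
    from * obtain c where c: "\<kappa> m = Suc c" using not0_implies_Suc by auto
    show "\<kappa>(m := \<kappa> m - 1) \<in> star_families (N - m) k"
      unfolding star_families_iff[OF diff_le_self] sums upd
      using h[unfolded sums] m c by auto
  qed
qed auto

text \<open>The factor \<open>Suc k\<close> is the sum of the entries \<open>\<kappa> m\<close>, and
  \<open>\<kappa> m * a m ^ \<kappa> m / fact (\<kappa> m)\<close> is \<open>a m\<close> times the
  factor for the entry lowered by 1. The result is the convolution recurrence that
  \<open>u ^ Suc k = u * u ^ k\<close> gives for coefficients.\<close>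

lemma sum_star_families_Suc:
  fixes a :: "nat \<Rightarrow> 'a :: field_char_0"
  shows "of_nat (Suc k) * (\<Sum>\<kappa>\<in>star_families N (Suc k). family_weight a \<kappa>) =
         (\<Sum>m=1..N. a m * (\<Sum>\<kappa>\<in>star_families (N - m) k. family_weight a \<kappa>))"
proof -
  let ?w = "family_weight a" and ?S = "star_families N (Suc k)"
  have "of_nat (Suc k) * (\<Sum>\<kappa>\<in>?S. ?w \<kappa>) = (\<Sum>\<kappa>\<in>?S. \<Sum>m=1..N. of_nat (\<kappa> m) * ?w \<kappa>)"
    unfolding sum_distrib_left sum_distrib_right[symmetric] of_nat_sum[symmetric]
    by (intro sum.cong) (simp_all add: star_families_iff[OF order_refl] del: of_nat_sum of_nat_Suc)
  also have "\<dots> = (\<Sum>m=1..N. \<Sum>\<kappa>\<in>?S. of_nat (\<kappa> m) * ?w \<kappa>)" by (rule sum.swap)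
  also have "\<dots> = (\<Sum>m=1..N. a m * (\<Sum>\<kappa>\<in>star_families (N - m) k. ?w \<kappa>))"
  proof (rule sum.cong[OF refl])
    fix m assume "m \<in> {1..N}"
    then have m: "1 \<le> m" "m \<le> N" and mA: "m \<in> {1..N}" by auto
    have "(\<Sum>\<kappa>\<in>?S. of_nat (\<kappa> m) * ?w \<kappa>) = (\<Sum>\<kappa>\<in>{\<kappa>\<in>?S. \<kappa> m \<noteq> 0}. of_nat (\<kappa> m) * ?w \<kappa>)"
      using finite_star_families by (intro sum.mono_neutral_right) auto
    also have "\<dots> = (\<Sum>\<kappa>\<in>star_families (N - m) k.
        of_nat (Suc (\<kappa> m)) * ?w (\<kappa>(m := Suc (\<kappa> m))))"
      using star_families_Suc_pos_bij[OF m, of k]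
      by (subst sum.reindex_bij_betw[symmetric]) auto
    also have "\<dots> = (\<Sum>\<kappa>\<in>star_families (N - m) k. a m * ?w \<kappa>)"
    proof (rule sum.cong[OF refl])
      fix \<kappa> assume \<kappa>: "\<kappa> \<in> star_families (N - m) k"
      let ?\<kappa> = "\<kappa>(m := Suc (\<kappa> m))"
      have "?\<kappa> \<in> ?S" using star_families_Suc_pos_bij[OF m, of k] \<kappa> by (auto dest: bij_betwE)
      then have "?w ?\<kappa> = (\<Prod>i=1..N. a i ^ ?\<kappa> i / fact (?\<kappa> i))"
        by (rule family_weight_eq_prod) simp
      also have "\<dots> = a m ^ Suc (\<kappa> m) / fact (Suc (\<kappa> m)) *
          (\<Prod>i\<in>{1..N} - {m}. a i ^ \<kappa> i / fact (\<kappa> i))"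
        using mA by (subst prod.remove[of _ m]) auto
      finally have "of_nat (Suc (\<kappa> m)) * ?w ?\<kappa> = a m * (a m ^ \<kappa> m / fact (\<kappa> m) *
          (\<Prod>i\<in>{1..N} - {m}. a i ^ \<kappa> i / fact (\<kappa> i)))"
        by (simp add: field_simps del: of_nat_Suc)
      also have "\<dots> = a m * (\<Prod>i=1..N. a i ^ \<kappa> i / fact (\<kappa> i))"
        using mA by (subst (2) prod.remove[of _ m]) auto
      finally show "of_nat (Suc (\<kappa> m)) * ?w ?\<kappa> = a m * ?w \<kappa>"
        using family_weight_eq_prod[OF \<kappa>, of N a] by simp
    qed
    finally show "(\<Sum>\<kappa>\<in>?S. of_nat (\<kappa> m) * ?w \<kappa>) = a m * (\<Sum>\<kappa>\<in>star_families (N - m) k. ?w \<kappa>)"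
      by (simp add: sum_distrib_left)
  qed
  finally show ?thesis .
qed

text \<open>The multinomial formula, by induction on \<open>k\<close>: both sides satisfy the same
  convolution recurrence.\<close>

lemma fps_power_nth_star_families:
  fixes a :: "nat \<Rightarrow> 'a :: field_char_0"
  shows "fps_nth (Abs_fps (\<lambda>m. if m = 0 then 0 else a m) ^ k) N =
    fact k * (\<Sum>\<kappa>\<in>star_families N k. family_weight a \<kappa>)"
proof (induction k arbitrary: N)
  case 0
  have "star_families N 0 = (if N = 0 then {\<lambda>_. 0} else {})"
    by (auto simp: star_families_def)
  then show ?case by (simp add: family_weight_def)
next
  case (Suc k)
  let ?u = "Abs_fps (\<lambda>m. if m = 0 then 0 else a m)"
  let ?T = "\<lambda>N k. \<Sum>\<kappa>\<in>star_families N k. family_weight a \<kappa>"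
  have "fps_nth (?u ^ Suc k) N = (\<Sum>m=0..N. fps_nth ?u m * fps_nth (?u ^ k) (N - m))"
    by (simp add: fps_mult_nth)
  also have "\<dots> = (\<Sum>m=1..N. fps_nth ?u m * fps_nth (?u ^ k) (N - m))"
    by (rule sum.mono_neutral_right) (auto simp: not_less_eq_eq)
  also have "\<dots> = (\<Sum>m=1..N. fact k * (a m * ?T (N - m) k))"
    by (intro sum.cong) (auto simp: Suc.IH)
  also have "\<dots> = fact k * (of_nat (Suc k) * ?T N (Suc k))"
    by (simp only: sum_distrib_left[symmetric] sum_star_families_Suc)
  finally show ?case by (simp add: algebra_simps)
qed

subsection \<open>Lagrange inversion\<close>

text \<open>For \<open>m > 0\<close> the series is \<open>-1/m\<close> times the derivative of
  \<open>inverse F ^ m\<close>, and derivatives have residue 0. For \<open>m = 0\<close> it is the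
  logarithmic derivative, whose residue is the order of \<open>F\<close>.\<close>

lemma fls_residue_inverse_power_times_deriv:
  fixes F :: "'a :: field_char_0 fls"
  shows "fls_residue (inverse F ^ Suc m * fls_deriv F) =
    (if m = 0 then of_int (fls_subdegree F) else 0)"
proof (cases "m = 0")
  case True
  then show ?thesis using fls_residue_deriv_times_inverse_eq_subdegree(2)[of F] by simp
next
  case False
  then obtain l where l: "m = Suc l" by (cases m) auto
  have "fls_deriv (inverse F ^ m) = of_nat m * inverse F ^ l * (- fls_deriv F * (inverse F)\<^sup>2)"
    by (simp only: fls_deriv_power fls_inverse_deriv l diff_Suc_1)
  also have "\<dots> = - (of_nat m * (inverse F ^ Suc m * fls_deriv F))"
    by (simp add: l power2_eq_square)
  finally have "fls_residue (of_nat m * (inverse F ^ Suc m * fls_deriv F)) = 0"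
    using fls_residue_deriv[of "inverse F ^ m"] by simp
  then have "fls_residue (fls_const (of_nat m) * (inverse F ^ Suc m * fls_deriv F)) = 0"
    by (simp add: fls_of_nat)
  then have "of_nat m * fls_residue (inverse F ^ Suc m * fls_deriv F) = 0"
    by (simp only: fls_residue_fls_const_times)
  then show ?thesis using False by simp
qed

lemma fps_to_fls_sum: "fps_to_fls (\<Sum>x\<in>A. f x) = (\<Sum>x\<in>A. fps_to_fls (f x))"
  by (induction A rule: infinite_finite_induct) auto

text \<open>Splits off the first \<open>n\<close> terms, so that a composition with \<open>f\<close>
  becomes a finite sum of powers of \<open>f\<close> plus a multiple of
  \<open>f ^ n\<close>.\<close>

lemma fps_eq_shift_plus_sum:
  "f = fps_X ^ n * fps_shift n f + (\<Sum>k<n. fps_const (fps_nth f k) * fps_X ^ k)"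
  for f :: "'a :: comm_ring_1 fps"
proof (rule fps_ext)
  fix i
  have "fps_nth (\<Sum>k<n. fps_const (fps_nth f k) * fps_X ^ k) i
      = (\<Sum>k<n. if k = i then fps_nth f i else 0)"
    unfolding fps_sum_nth by (intro sum.cong) auto
  then show "fps_nth f i = fps_nth (fps_X ^ n * fps_shift n f + (\<Sum>k<n. fps_const (fps_nth f k) * fps_X ^ k)) i"
    by (simp add: fps_X_power_mult_nth)
qed

text \<open>Composing \<open>g' = \<Sum>\<^sub>k (k + 1) g\<^sub>k\<^sub>+\<^sub>1 X\<^sup>k\<close> with \<open>f\<close> and multiplying by \<open>f' / f\<^sup>n\<close> gives
  \<open>f\<^sup>-\<^sup>n = \<Sum>\<^sub>k (k + 1) g\<^sub>k\<^sub>+\<^sub>1 f\<^sup>k\<^sup>-\<^sup>n f'\<close>, where only the term \<open>k = n - 1\<close> has a nonzero residue.\<close>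

theorem Lagrange_inversion:
  fixes f g :: "'a :: field_char_0 fps"
  assumes f0: "fps_nth f 0 = 0" and f1: "fps_nth f 1 \<noteq> 0" and gf: "g oo f = fps_X" and n: "n \<ge> 1"
  shows "of_nat n * fps_nth g n = fps_nth (inverse (fps_shift 1 f) ^ n) (n - 1)"
proof -
  define F where "F = fps_to_fls f"
  \<comment> \<open>\<open>f ^ n * R\<close> is the tail of the composed derivative from
    \<open>k = n\<close> on. Divided by \<open>f ^ n\<close> and multiplied by \<open>f'\<close> it
    is still a power series, hence without residue.\<close>
  define R where "R = fps_shift n (fps_deriv g) oo f"
  define c where "c = fps_nth (fps_deriv g)"
  let ?D = "fps_deriv f" and ?I = "inverse F"
  have F: "F \<noteq> 0" using f1 by (auto simp: F_def)
  have sub: "subdegree f = 1" using f0 f1 by (intro subdegreeI) auto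
  then have subF: "fls_subdegree F = 1" by (simp add: F_def fls_subdegree_fls_to_fps)
  have DF: "fls_deriv F = fps_to_fls ?D" by (simp add: F_def fls_deriv_fps_to_fls)
  have "fps_deriv g oo f = f ^ n * R + (\<Sum>k<n. fps_const (c k) * f ^ k)"
    by (subst fps_eq_shift_plus_sum[of _ n])
       (simp add: fps_compose_add_distrib fps_compose_mult_distrib[OF f0] fps_compose_sum_distrib
          fps_compose_power[OF f0, symmetric] f0 R_def c_def del: fps_deriv_nth)
  moreover have "(fps_deriv g oo f) * ?D = 1"
    using fps_compose_deriv[OF f0, of g] gf by simp
  ultimately have "1 = (f ^ n * R + (\<Sum>k<n. fps_const (c k) * f ^ k)) * ?D" by simp
  also have "\<dots> = f ^ n * (R * ?D) + (\<Sum>k<n. fps_const (c k) * f ^ k * ?D)"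
    by (simp add: algebra_simps sum_distrib_left sum_distrib_right)
  finally have "fps_to_fls 1 = fps_to_fls \<dots>" by simp
  then have "1 = F ^ n * fps_to_fls (R * ?D) + (\<Sum>k<n. fls_const (c k) * F ^ k * fls_deriv F)"
    by (simp add: fls_times_fps_to_fls fps_to_fls_power F_def[symmetric] DF[symmetric]
       fps_to_fls_sum fps_const_to_fls)
  then have "?I ^ n * 1 = ?I ^ n * (F ^ n * fps_to_fls (R * ?D) + (\<Sum>k<n. fls_const (c k) * F ^ k * fls_deriv F))"
    by simp
  also have "\<dots> = (?I ^ n * F ^ n) * fps_to_fls (R * ?D) + (\<Sum>k<n. fls_const (c k) * ((?I ^ n * F ^ k) * fls_deriv F))"
    by (simp add: algebra_simps sum_distrib_left)
  also have "?I ^ n * F ^ n = 1" using F by (simp flip: power_mult_distrib)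
  \<comment> \<open>The exponent \<open>n - k\<close> is written as \<open>Suc (n - 1 - k)\<close>
    to fit the residue lemma, whose nonzero case is then \<open>k = n - 1\<close>.\<close>
  also have "(\<Sum>k<n. fls_const (c k) * ((?I ^ n * F ^ k) * fls_deriv F)) =
     (\<Sum>k<n. fls_const (c k) * (?I ^ Suc (n - 1 - k) * fls_deriv F))"
  proof (intro sum.cong refl)
    fix k assume "k \<in> {..<n}"
    then have "n = Suc (n - 1 - k) + k" by simp
    then have "?I ^ n * F ^ k = ?I ^ Suc (n - 1 - k) * (?I ^ k * F ^ k)"
      by (metis power_add mult.assoc)
    also have "?I ^ k * F ^ k = 1" using F by (simp flip: power_mult_distrib)
    finally show "fls_const (c k) * ((?I ^ n * F ^ k) * fls_deriv F) = fls_const (c k) * (?I ^ Suc (n - 1 - k) * fls_deriv F)"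
      by simp
  qed
  finally have "fls_residue (?I ^ n) = fls_residue (fps_to_fls (R * ?D)) +
     (\<Sum>k<n. fls_residue (fls_const (c k) * (?I ^ Suc (n - 1 - k) * fls_deriv F)))"
    by (simp add: fls_nth_sum)
  also have "\<dots> = (\<Sum>k<n. c k * fls_residue (?I ^ Suc (n - 1 - k) * fls_deriv F))"
    by (simp only: fls_residue_fls_const_times) simp
  also have "\<dots> = (\<Sum>k<n. if k = n - 1 then c k else 0)"
    unfolding fls_residue_inverse_power_times_deriv subF by (intro sum.cong) auto
  also have "\<dots> = of_nat n * fps_nth g n" using n by (simp add: c_def of_nat_diff)
  finally have res: "fls_residue (?I ^ n) = of_nat n * fps_nth g n" .

  \<comment> \<open>Since \<open>f = X * ?\<phi>\<close>, the coefficient of \<open>X^-1\<close> in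
    \<open>f^-n\<close> is that of \<open>X^(n-1)\<close> in \<open>?\<phi>^-n\<close>.\<close>
  let ?\<phi> = "fps_shift 1 f"
  have "f = fps_X * ?\<phi>"
    using f0 by (auto simp: fps_eq_iff)
  then have "F = fls_X * fps_to_fls ?\<phi>" unfolding F_def
    by (metis fls_times_fps_to_fls fps_X_to_fls)
  moreover have "inverse (fps_to_fls ?\<phi>) = fps_to_fls (inverse ?\<phi>)"
    using f1 by (intro fls_inverse_fps_to_fls) simp
  ultimately have "?I = fls_X_inv * fps_to_fls (inverse ?\<phi>)"
    by (simp add: fls_inverse_X)
  then have "?I ^ n = fls_X_inv ^ n * fps_to_fls (inverse ?\<phi> ^ n)"
    by (simp add: power_mult_distrib fps_to_fls_power)
  then have "?I ^ n = fls_shift (int n) (fps_to_fls (inverse ?\<phi> ^ n))"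
    by (simp add: fls_X_inv_power_times_conv_shift)
  then have "fls_residue (?I ^ n) = fps_nth (inverse ?\<phi> ^ n) (n - 1)"
    using n by (simp add: nat_diff_distrib)
  with res show ?thesis by simp
qed

text \<open>Substitute \<open>u\<close> into the binomial series of \<open>(1 + X)^-n\<close>, whose
  \<open>k\<close>-th coefficient is \<open>(-1)^k [n]_k / k!\<close>. The zero constant term of
  \<open>u\<close> makes the composition legitimate and ends the sum at \<open>N\<close>.\<close>

lemma fps_inverse_one_plus_power_nth:
  fixes u :: "'a :: field_char_0 fps"
  assumes "fps_nth u 0 = 0"
  shows "fps_nth (inverse (1 + u) ^ n) N =
    (\<Sum>k=0..N. (-1) ^ k * pochhammer (of_nat n) k / fact k * fps_nth (u ^ k) N)"
proof -
  have "inverse (1 + u) = inverse (1 + fps_X) oo u"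
    using assms by (subst fps_inverse_compose) (simp_all add: fps_compose_add_distrib)
  then have "inverse (1 + u) ^ n = inverse ((1 + fps_X) ^ n) oo u"
    using assms by (simp add: fps_compose_power fps_inverse_power)
  also have "\<dots> = fps_binomial (- of_nat n) oo u" by (simp add: fps_binomial_minus_of_nat)
  finally show ?thesis by (simp add: fps_compose_nth gbinomial_pochhammer)
qed

text \<open>Here \<open>f / X = pmf \<pi> 1 * (1 + u)\<close>, where \<open>u\<close> has the ratios
  \<open>a m\<close> as coefficients. In \<open>(f / X)^-n\<close> the power of
  \<open>pmf \<pi> 1\<close> factors out, and the \<open>k!\<close> of the multinomial formula
  cancels that of the binomial coefficient.\<close>

lemma fps_inv_pmf_nth:
  assumes p0: "pmf \<pi> 0 = 0" and p1: "pmf \<pi> 1 \<noteq> 0" and n: "n \<ge> 1"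
  shows "fps_nth (fps_inv (Abs_fps (pmf \<pi>))) n = h_coeff \<pi> n / pmf \<pi> 1 ^ n"
proof -
  define a where "a = (\<lambda>m. pmf \<pi> (m + 1) / pmf \<pi> 1)"
  define u where "u = Abs_fps (\<lambda>m. if m = 0 then 0 else a m)"
  let ?f = "Abs_fps (pmf \<pi>)"
  have "fps_shift 1 ?f = fps_const (pmf \<pi> 1) * (1 + u)"
    using p1 by (simp add: fps_eq_iff u_def a_def)
  then have inv: "inverse (fps_shift 1 ?f) ^ n = fps_const (1 / pmf \<pi> 1 ^ n) * inverse (1 + u) ^ n"
    using p1 by (simp add: fps_inverse_mult power_mult_distrib fps_const_inverse
      fps_const_power inverse_eq_divide power_divide)
  have C: "fact k * C_coeff \<pi> N k = fps_nth (u ^ k) N" if "k \<ge> 1" for k N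
    using that unfolding u_def fps_power_nth_star_families
    by (simp add: C_coeff_def family_weight_def a_def)
  have u0: "fps_nth u 0 = 0" by (simp add: u_def)
  have "of_nat n * fps_nth (fps_inv ?f) n = fps_nth (inverse (fps_shift 1 ?f) ^ n) (n - 1)"
    using p0 p1 n by (intro Lagrange_inversion fps_inv) simp_all
  also have "\<dots> = 1 / pmf \<pi> 1 ^ n *
      (\<Sum>k=0..n - 1. (-1) ^ k * pochhammer (real n) k / fact k * fps_nth (u ^ k) (n - 1))"
    unfolding inv fps_mult_left_const_nth fps_inverse_one_plus_power_nth[OF u0] ..
  also have "(\<Sum>k=0..n - 1. (-1) ^ k * pochhammer (real n) k / fact k * fps_nth (u ^ k) (n - 1))
      = real n * h_coeff \<pi> n"
  \<comment> \<open>The term \<open>k = 0\<close> is the whole sum if \<open>n = 1\<close>;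
    otherwise it vanishes, because \<open>u ^ 0 = 1\<close> has coefficient 0 at
    \<open>n - 1 > 0\<close>.\<close>
  proof (cases "n = 1")
    case True then show ?thesis by (simp add: h_coeff_def)
  next
    case False
    have "(\<Sum>k=0..n - 1. (-1) ^ k * pochhammer (real n) k / fact k * fps_nth (u ^ k) (n - 1))
        = (\<Sum>k=1..n - 1. (-1) ^ k * pochhammer (real n) k / fact k * fps_nth (u ^ k) (n - 1))"
      using False n by (intro sum.mono_neutral_right) (auto simp: not_less_eq_eq)
    also have "\<dots> = (\<Sum>k=1..n - 1. (-1) ^ k * pochhammer (real n) k * C_coeff \<pi> (n - 1) k)"
      by (intro sum.cong refl) (simp flip: C)
    finally show ?thesis using False n by (simp add: h_coeff_def)
  qed
  finally have "real n * fps_nth (fps_inv ?f) n = real n * (h_coeff \<pi> n / pmf \<pi> 1 ^ n)" by simp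
  then show ?thesis using n by (simp only: mult_cancel_left) simp
qed

subsection \<open>Convergence of the inverse series\<close>

text \<open>Summation by parts: with \<open>b n\<close> the error of the \<open>n\<close>-th partial
  sum, the power series minus \<open>S\<close> equals \<open>(1 - x)\<close> times the series of
  \<open>b n * x ^ n\<close>. The factor \<open>1 - x\<close> kills any finite part, and the tail is
  small because \<open>b\<close> tends to 0.\<close>

theorem Abel_limit:
  fixes a :: "nat \<Rightarrow> real"
  assumes "summable a"
  shows "((\<lambda>x. \<Sum>n. a n * x ^ n) \<longlongrightarrow> suminf a) (at_left 1)"
proof -
  define S b where "S = suminf a" and "b = (\<lambda>n. (\<Sum>k\<le>n. a k) - S)"
  have "(\<lambda>n. \<Sum>k\<le>n. a k) \<longlonglongrightarrow> S"
    using summable_LIMSEQ'[OF assms] by (simp add: S_def)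
  then have b0: "b \<longlonglongrightarrow> 0" unfolding b_def by (simp add: LIM_zero)
  then obtain B where B: "\<And>n. norm (b n) \<le> B"
    using convergent_imp_Bseq[of b] by (auto simp: convergent_def Bseq_def)
  have sb: "summable (\<lambda>n. \<bar>b n\<bar> * x ^ n)" if "0 \<le> x" "x < 1" for x
  proof (rule summable_comparison_test')
    show "summable (\<lambda>n. B * x ^ n)" using that by (intro summable_mult summable_geometric) auto
    show "norm (\<bar>b n\<bar> * x ^ n) \<le> B * x ^ n" for n
      using that B[of n] by (simp add: abs_mult mult_right_mono)
  qed
  have sb': "summable (\<lambda>n. b n * x ^ n)" if "0 \<le> x" "x < 1" for x
  proof (rule summable_rabs_cancel)
    show "summable (\<lambda>n. \<bar>b n * x ^ n\<bar>)" using sb[OF that] that by (simp add: abs_mult)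
  qed
  have key: "(\<Sum>n. a n * x ^ n) - S = (1 - x) * (\<Sum>n. b n * x ^ n)" if x: "0 \<le> x" "x < 1" for x
  proof -
    have s: "(\<lambda>n. b n * x ^ n) sums (\<Sum>n. b n * x ^ n)" using sb'[OF x] by (rule summable_sums)
    from s have "(\<lambda>n. b (Suc n) * x ^ Suc n) sums ((\<Sum>n. b n * x ^ n) - b 0)"
      by (subst sums_Suc_iff) simp
    moreover from s have "(\<lambda>n. x * (b n * x ^ n)) sums (x * (\<Sum>n. b n * x ^ n))" by (rule sums_mult)
    ultimately have "(\<lambda>n. b (Suc n) * x ^ Suc n - x * (b n * x ^ n)) sums
        ((\<Sum>n. b n * x ^ n) - b 0 - x * (\<Sum>n. b n * x ^ n))" by (rule sums_diff)
    also have "(\<lambda>n. b (Suc n) * x ^ Suc n - x * (b n * x ^ n)) = (\<lambda>n. a (Suc n) * x ^ Suc n)"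
      by (auto simp: b_def algebra_simps)
    finally have "(\<lambda>n. a n * x ^ n) sums ((\<Sum>n. b n * x ^ n) - b 0 - x * (\<Sum>n. b n * x ^ n) + a 0)"
      by (subst (asm) sums_Suc_iff) simp
    then show ?thesis by (simp add: sums_iff b_def algebra_simps)
  qed
  have "((\<lambda>x. (\<Sum>n. a n * x ^ n) - S) \<longlongrightarrow> 0) (at_left 1)"
  proof (rule tendstoI)
    fix e :: real assume e: "e > 0"
    obtain N where N: "\<And>n. n \<ge> N \<Longrightarrow> \<bar>b n\<bar> < e / 2"
      using LIMSEQ_D[OF b0, of "e / 2"] e by (metis diff_zero half_gt_zero real_norm_def)
    \<comment> \<open>\<open>M\<close> bounds the first \<open>N\<close> terms uniformly in
      \<open>x\<close>; the remaining ones are compared with a geometric series, whose sum cancels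
      \<open>1 - x\<close>.\<close>
    define M where "M = (\<Sum>n<N. \<bar>b n\<bar>)"
    have bound: "\<bar>(\<Sum>n. a n * x ^ n) - S\<bar> \<le> (1 - x) * M + e / 2" if x: "0 \<le> x" "x < 1" for x
    proof -
      let ?c = "\<lambda>n. if n < N then \<bar>b n\<bar> else 0"
      have c: "?c sums M"
        using sums_If_finite_set[of "{..<N}" "\<lambda>n. \<bar>b n\<bar>"] by (simp add: M_def)
      have g: "(\<lambda>n. e / 2 * x ^ n) sums (e / 2 * (1 / (1 - x)))"
        using x by (intro sums_mult geometric_sums) auto
      have "\<bar>\<Sum>n. b n * x ^ n\<bar> \<le> (\<Sum>n. \<bar>b n\<bar> * x ^ n)"
        using summable_rabs[of "\<lambda>n. b n * x ^ n"] sb[OF x] x by (simp add: abs_mult)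
      also have "\<dots> \<le> (\<Sum>n. ?c n + e / 2 * x ^ n)"
      proof (rule suminf_le)
        fix n
        have p: "0 \<le> x ^ n" "x ^ n \<le> 1" using x by (auto intro: power_le_one)
        show "\<bar>b n\<bar> * x ^ n \<le> ?c n + e / 2 * x ^ n"
        proof (cases "n < N")
          case True
          have "\<bar>b n\<bar> * x ^ n \<le> \<bar>b n\<bar> * 1" using p by (intro mult_left_mono) auto
          moreover have "0 \<le> e / 2 * x ^ n" using p e by simp
          ultimately show ?thesis using True by simp
        next
          case False
          then have "\<bar>b n\<bar> * x ^ n \<le> e / 2 * x ^ n"
            using p N[of n] by (intro mult_right_mono) auto
          then show ?thesis using False by simp
        qed
      qed (use sb[OF x] sums_summable[OF sums_add[OF c g]] in auto)
      also have "\<dots> = M + e / 2 * (1 / (1 - x))" using sums_add[OF c g] by (rule sums_unique[symmetric])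
      finally have "(1 - x) * \<bar>\<Sum>n. b n * x ^ n\<bar> \<le> (1 - x) * (M + e / 2 * (1 / (1 - x)))"
        using x by (intro mult_left_mono) auto
      also have "\<dots> = (1 - x) * M + e / 2" using x by (simp add: field_simps)
      finally show ?thesis using x by (simp add: key[OF x] abs_mult)
    qed
    have "((\<lambda>x. (1 - x) * M + e / 2) \<longlongrightarrow> (1 - 1) * M + e / 2) (at_left 1)"
      by (intro tendsto_intros)
    then have "eventually (\<lambda>x. (1 - x) * M + e / 2 < e) (at_left 1)"
      using e by (intro order_tendstoD(2)[of _ "e / 2"]) auto
    moreover have "eventually (\<lambda>x::real. x \<in> {0<..<1}) (at_left 1)"
      by (rule eventually_at_left_real) simp
    ultimately show "eventually (\<lambda>x. dist ((\<Sum>n. a n * x ^ n) - S) 0 < e) (at_left 1)"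
    proof eventually_elim
      case (elim x)
      then show ?case using bound[of x] by simp
    qed
  qed
  then show ?thesis by (simp add: S_def LIM_zero_iff)
qed

section \<open>Positive radius of convergence of the compositional inverse\<close>

text \<open>The sum of \<open>F\<close> is holomorphic with nonzero derivative at 0, so it has a
  local holomorphic inverse. The Taylor series of that inverse has positive radius, and its
  composition with \<open>F\<close> is \<open>X\<close>, so it is \<open>fps_inv F\<close>.\<close>

lemma fps_conv_radius_fps_inv_pos:
  fixes F :: "complex fps"
  assumes "fps_conv_radius F > 0" and F0: "fps_nth F 0 = 0" and F1: "fps_nth F 1 \<noteq> 0"
  shows "fps_conv_radius (fps_inv F) > 0"
proof -
  define f where "f = eval_fps F"
  have ff: "f has_fps_expansion F" unfolding f_def using assms(1) by (rule eval_fps_has_fps_expansion)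
  have f0: "f 0 = 0" by (simp add: f_def eval_fps_at_0 F0)
  have hol: "f holomorphic_on eball 0 (fps_conv_radius F)"
    unfolding f_def by (intro holomorphic_on_eval_fps) auto
  have z: "0 \<in> eball (0::complex) (fps_conv_radius F)"
    using assms(1) by (simp add: in_eball_iff zero_ereal_def)
  have d: "deriv f 0 \<noteq> 0"
    using has_fps_expansion_deriv[OF ff] F1
    by (simp add: has_fps_expansion_imp_0_eq_fps_nth_0)
  obtain r where r: "r > 0" "ball (0::complex) r \<subseteq> eball 0 (fps_conv_radius F)" "inj_on f (ball 0 r)"
    using has_complex_derivative_locally_injective[OF hol z open_eball d] .
  have hol': "f holomorphic_on ball 0 r" using hol r(2) by (rule holomorphic_on_subset)
  obtain g where g: "g holomorphic_on f ` ball 0 r" "\<And>z. z \<in> ball 0 r \<Longrightarrow> deriv f z * deriv g (f z) = 1"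
      "\<And>z. z \<in> ball 0 r \<Longrightarrow> g (f z) = z"
    using holomorphic_has_inverse[OF hol' open_ball r(3)] by metis
  have "open (f ` ball 0 r)" using hol' r(3) by (intro open_mapping_thm3) auto
  moreover have "0 \<in> f ` ball 0 r" using f0 r(1) by force
  ultimately have gG: "g has_fps_expansion fps_expansion g 0"
    using g(1) by (intro has_fps_expansion_fps_expansion)
  have "(g \<circ> f) has_fps_expansion (fps_expansion g 0 oo F)"
    by (rule has_fps_expansion_compose[OF gG ff F0])
  moreover have "eventually (\<lambda>z. (g \<circ> f) z = z) (nhds 0)"
    using eventually_nhds_in_open[of "ball 0 r" 0] r(1) g(3) by (auto elim: eventually_mono)
  ultimately have "(\<lambda>z. z) has_fps_expansion (fps_expansion g 0 oo F)"
    using has_fps_expansion_cong[of "g \<circ> f" "\<lambda>z. z", OF _ refl] by simp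
  then have "fps_expansion g 0 oo F = fps_X"
    using has_fps_expansion_fps_X by (rule fps_expansion_unique_complex)
  then have "fps_expansion g 0 = fps_inv F"
    using fps_inv[OF F0 F1] fps_compose_inj_right[OF F0 F1] by metis
  then show ?thesis using gG by (simp add: has_fps_expansion_def)
qed

text \<open>Transports real series to the complex plane, where holomorphic inverses and the identity
  theorem are available.\<close>

definition fps_complex :: "real fps \<Rightarrow> complex fps" where
  "fps_complex f = Abs_fps (\<lambda>n. complex_of_real (fps_nth f n))"

lemma fps_complex_nth [simp]: "fps_nth (fps_complex f) n = complex_of_real (fps_nth f n)"
  by (simp add: fps_complex_def)

lemma fps_complex_power: "fps_complex (f ^ k) = fps_complex f ^ k"
  by (induction k) (auto simp: fps_eq_iff fps_mult_nth)

lemma fps_complex_compose: "fps_complex (f oo g) = fps_complex f oo fps_complex g"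
  by (simp add: fps_eq_iff fps_compose_nth flip: fps_complex_power)

lemma fps_complex_X [simp]: "fps_complex fps_X = fps_X"
  by (simp add: fps_eq_iff)

lemma fps_conv_radius_fps_complex [simp]: "fps_conv_radius (fps_complex f) = fps_conv_radius f"
  unfolding fps_conv_radius_def conv_radius_def by simp

lemma eval_fps_complex_of_real:
  assumes "ereal \<bar>x\<bar> < fps_conv_radius f"
  shows "eval_fps (fps_complex f) (complex_of_real x) = complex_of_real (eval_fps f x)"
proof -
  have "(\<lambda>n. fps_nth f n * x ^ n) sums eval_fps f x"
    using assms by (intro sums_eval_fps) simp
  then have "(\<lambda>n. complex_of_real (fps_nth f n * x ^ n)) sums complex_of_real (eval_fps f x)"
    by (rule sums_of_real)
  then show ?thesis by (simp add: eval_fps_def sums_iff)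
qed

text \<open>The embedding commutes with composition, so by uniqueness of compositional inverses it
  also commutes with \<open>fps_inv\<close>; it preserves radii.\<close>

lemma fps_conv_radius_fps_inv_pos_real:
  fixes f :: "real fps"
  assumes "fps_conv_radius f > 0" and f0: "fps_nth f 0 = 0" and f1: "fps_nth f 1 \<noteq> 0"
  shows "fps_conv_radius (fps_inv f) > 0"
proof -
  have "fps_complex (fps_inv f) oo fps_complex f = fps_inv (fps_complex f) oo fps_complex f"
    using f0 f1 by (simp add: fps_inv fps_complex_X flip: fps_complex_compose)
  then have "fps_complex (fps_inv f) = fps_inv (fps_complex f)"
    using f0 f1 by (subst (asm) fps_compose_inj_right) auto
  moreover have "fps_conv_radius (fps_inv (fps_complex f)) > 0"
    using assms by (intro fps_conv_radius_fps_inv_pos) auto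
  ultimately show ?thesis using fps_conv_radius_fps_complex[of "fps_inv f"] by simp
qed

text \<open>The linear term alone is strictly increasing, and every other term is
  nondecreasing.\<close>

lemma powser_strict_mono_on:
  fixes p :: "nat \<Rightarrow> real"
  assumes p: "\<And>n. p n \<ge> 0" "p 1 > 0" "summable p"
  shows "strict_mono_on {0..1} (\<lambda>x. \<Sum>n. p n * x ^ n)"
proof (rule strict_mono_onI)
  fix x y :: real assume xy: "x \<in> {0..1}" "y \<in> {0..1}" "x < y"
  have s: "summable (\<lambda>n. p n * z ^ n)" if "z \<in> {0..1}" for z
  proof (rule summable_comparison_test'[OF p(3)])
    show "norm (p n * z ^ n) \<le> p n" for n
      using that p(1)[of n] by (simp add: abs_mult power_le_one mult_left_le)
  qed
  have "0 < p 1 * y ^ 1 - p 1 * x ^ 1" using p(2) xy(3) by (simp add: algebra_simps)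
  also have "\<dots> = (\<Sum>n\<in>{1}. p n * y ^ n - p n * x ^ n)" by simp
  also have "\<dots> \<le> (\<Sum>n. p n * y ^ n - p n * x ^ n)"
    using xy p(1) by (intro sum_le_suminf summable_diff s) (auto intro!: mult_left_mono power_mono)
  also have "\<dots> = (\<Sum>n. p n * y ^ n) - (\<Sum>n. p n * x ^ n)"
    using xy by (intro suminf_diff[symmetric] s)
  finally show "(\<Sum>n. p n * x ^ n) < (\<Sum>n. p n * y ^ n)" by simp
qed

text \<open>As the coefficients \<open>p n\<close> are nonnegative, \<open>\<bar>\<Phi> z\<bar> \<le> \<Phi> \<bar>z\<bar>\<close>. Hence \<open>\<Phi>\<close> maps the complex disc of
  radius \<open>y\<close> into the disc of radius \<open>\<Phi> y\<close>, where the inverse series converges, and the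
  identity theorem on the former disc gives \<open>G (\<Phi> z) = z\<close> there. The boundary point \<open>y\<close> itself
  is reached by Abel's theorem.\<close>

theorem suminf_fps_inv_powser:
  fixes p :: "nat \<Rightarrow> real"
  assumes p: "\<And>n. p n \<ge> 0" "p 0 = 0" "p 1 > 0" "summable p"
  assumes y: "0 < y" "y < 1" and w: "w = (\<Sum>n. p n * y ^ n)"
  assumes sum: "summable (\<lambda>n. fps_nth (fps_inv (Abs_fps p)) n * w ^ n)"
  shows "(\<Sum>n. fps_nth (fps_inv (Abs_fps p)) n * w ^ n) = y"
proof -
  define f g where "f = Abs_fps p" and "g = fps_inv f"
  define \<Phi> where "\<Phi> = eval_fps f"
  have \<Phi>: "\<Phi> x = (\<Sum>n. p n * x ^ n)" for x by (simp add: \<Phi>_def f_def eval_fps_def)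
  have mono: "\<Phi> x < \<Phi> x'" if "0 \<le> x" "x < x'" "x' \<le> 1" for x x'
    unfolding \<Phi> using that strict_mono_onD[OF powser_strict_mono_on[OF p(1,3,4)], of x x'] by simp
  have w\<Phi>: "w = \<Phi> y" using w \<Phi> by simp
  have \<Phi>0: "\<Phi> 0 = 0" by (simp add: \<Phi>_def f_def eval_fps_at_0 p(2))
  have wpos: "w > 0" using mono[of 0 y] y \<Phi>0 w\<Phi> by simp
  \<comment> \<open>Each radius is bounded below by convergence at one point: 1 for
    \<open>f\<close>, and \<open>w\<close> for \<open>g\<close>.\<close>
  have rf: "fps_conv_radius f \<ge> 1"
    using conv_radius_geI[of p 1] p(4) by (simp add: fps_conv_radius_def f_def one_ereal_def)
  have rg: "fps_conv_radius g \<ge> ereal w"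
    using conv_radius_geI[of "fps_nth g" w] sum wpos by (simp add: fps_conv_radius_def g_def f_def)
  have f01: "fps_nth f 0 = 0" "fps_nth f 1 \<noteq> 0" using p by (auto simp: f_def)
  let ?F = "fps_complex f" and ?G = "fps_complex g"
  have bnd: "norm (eval_fps ?F z) < w" if z: "norm z < y" for z
  proof -
    have "norm z < fps_conv_radius f" using z y rf
      by (metis ereal_less(3) less_ereal.simps(1) less_le_trans order.strict_trans)
    then have "summable (\<lambda>n. norm (fps_nth ?F n * z ^ n))"
      by (intro norm_summable_fps) simp
    then have "norm (eval_fps ?F z) \<le> (\<Sum>n. norm (fps_nth ?F n * z ^ n))"
      unfolding eval_fps_def by (rule summable_norm)
    also have "\<dots> = \<Phi> (norm z)"
      unfolding \<Phi> using p(1) by (simp add: norm_mult norm_power f_def)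
    also have "\<dots> < w" unfolding w\<Phi> using z y by (intro mono) auto
    finally show ?thesis .
  qed
  have id: "eval_fps ?G (eval_fps ?F z) = z" if z: "norm z < y" for z
  proof -
    have holF: "eval_fps ?F holomorphic_on ball 0 y"
    proof (rule holomorphic_on_eval_fps)
      show "ball 0 y \<subseteq> eball 0 (fps_conv_radius ?F)"
        using y(2) rf by (auto simp: ereal_less_le less_le_trans[of _ 1] intro!: less_le_trans[of _ 1 "fps_conv_radius f"])
    qed
    have holG: "eval_fps ?G holomorphic_on ball 0 w"
    proof (rule holomorphic_on_eval_fps)
      show "ball 0 w \<subseteq> eball 0 (fps_conv_radius ?G)"
        using rg by (auto intro!: less_le_trans[of _ "ereal w" "fps_conv_radius g"])
    qed
    have "(\<lambda>z. (eval_fps ?G \<circ> eval_fps ?F) z - z) holomorphic_on ball 0 y"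
      using bnd by (intro holomorphic_intros holomorphic_on_compose_gen[OF holF holG]) auto
    moreover have "eval_fps ?G has_fps_expansion ?G"
      using rg wpos by (intro eval_fps_has_fps_expansion) (auto intro: less_le_trans[of _ "ereal w"])
    moreover have "eval_fps ?F has_fps_expansion ?F"
      using rf by (intro eval_fps_has_fps_expansion) (auto intro: less_le_trans[of _ 1])
    ultimately have "(\<lambda>z. (eval_fps ?G \<circ> eval_fps ?F) z - z) has_fps_expansion (?G oo ?F) - fps_X"
      using f01(1) by (intro has_fps_expansion_diff has_fps_expansion_compose has_fps_expansion_fps_X) auto
    also have "(?G oo ?F) - fps_X = 0"
      using f01 by (simp add: g_def fps_inv flip: fps_complex_compose)
    finally have "(eval_fps ?G \<circ> eval_fps ?F) z - z = 0"
      using \<open>(\<lambda>z. (eval_fps ?G \<circ> eval_fps ?F) z - z) holomorphic_on ball 0 y\<close> z y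
      by (intro has_fps_expansion_0_analytic_continuation[of _ "ball 0 y"]) auto
    then show ?thesis by simp
  qed
  have idr: "eval_fps g (\<Phi> t) = t" if t: "0 \<le> t" "t < y" for t
  proof -
    have 1: "ereal \<bar>t\<bar> < fps_conv_radius f"
      using t y rf by (intro less_le_trans[of _ 1 "fps_conv_radius f"]) auto
    have "0 \<le> \<Phi> t" using mono[of 0 t] \<Phi>0 t y by (cases "t = 0") auto
    moreover have "\<Phi> t < w" unfolding w\<Phi> using t y by (intro mono) auto
    ultimately have 2: "ereal \<bar>\<Phi> t\<bar> < fps_conv_radius g"
      using rg by (intro less_le_trans[of _ "ereal w" "fps_conv_radius g"]) auto
    have "complex_of_real (eval_fps g (\<Phi> t)) = eval_fps ?G (eval_fps ?F (complex_of_real t))"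
      using 1 2 by (simp add: eval_fps_complex_of_real \<Phi>_def)
    also have "\<dots> = complex_of_real t" using t by (intro id) simp
    finally show ?thesis by simp
  qed
  \<comment> \<open>Abel's theorem is applied to the terms \<open>fps_nth g n * w ^ n\<close> in the
    variable \<open>\<Phi> t / w\<close>, which tends to 1 from below because \<open>\<Phi>\<close>
    is strictly increasing and continuous at \<open>y\<close>.\<close>
  have lim: "filterlim (\<lambda>t. \<Phi> t / w) (at_left 1) (at_left y)"
  proof -
    have "isCont \<Phi> y" unfolding \<Phi>_def
      using y rf by (intro continuous_eval_fps continuous_ident) (auto intro!: less_le_trans[of _ 1 "fps_conv_radius f"])
    then have "(\<Phi> \<longlongrightarrow> \<Phi> y) (at_left y)"
      by (auto simp: isCont_def intro: filterlim_mono at_le)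
    then have "((\<lambda>t. \<Phi> t / w) \<longlongrightarrow> w / w) (at_left y)"
      unfolding w\<Phi> using wpos w\<Phi> by (intro tendsto_intros) auto
    moreover have "eventually (\<lambda>t. t \<in> {0<..<y}) (at_left y)"
      using y by (intro eventually_at_left_real)
    then have "eventually (\<lambda>t. \<Phi> t / w < 1) (at_left y)"
      by eventually_elim (use mono[of _ y] w\<Phi> wpos y in auto)
    ultimately show ?thesis using wpos by (simp add: filterlim_at eventually_mono)
  qed
  have "((\<lambda>t. \<Sum>n. fps_nth g n * w ^ n * (\<Phi> t / w) ^ n) \<longlongrightarrow> (\<Sum>n. fps_nth g n * w ^ n)) (at_left y)"
    using filterlim_compose[OF Abel_limit lim] sum by (simp add: g_def f_def)
  moreover have "eventually (\<lambda>t. t \<in> {0<..<y}) (at_left y)"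
    using y by (intro eventually_at_left_real)
  then have "eventually (\<lambda>t. (\<Sum>n. fps_nth g n * w ^ n * (\<Phi> t / w) ^ n) = t) (at_left y)"
  proof eventually_elim
    case (elim t)
    have "(\<Sum>n. fps_nth g n * w ^ n * (\<Phi> t / w) ^ n) = eval_fps g (\<Phi> t)"
      using wpos by (simp add: eval_fps_def power_divide)
    then show ?case using idr[of t] elim by simp
  qed
  ultimately have "((\<lambda>t. t) \<longlongrightarrow> (\<Sum>n. fps_nth g n * w ^ n)) (at_left y)"
    by (rule Lim_transform_eventually)
  moreover have "((\<lambda>t. t) \<longlongrightarrow> y) (at_left y)" by (rule tendsto_ident_at)
  ultimately have "(\<Sum>n. fps_nth g n * w ^ n) = y"
    by (intro tendsto_unique[of "at_left y"]) auto
  then show ?thesis by (simp add: g_def f_def)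
qed

subsection \<open>Existence, uniqueness and injectivity\<close>

lemma pmf_nat_sums_1: "pmf p sums 1" for p :: "nat pmf"
proof -
  note s = pmf_abs_summable[of p UNIV]
  from s have "summable (pmf p)" by (simp add: abs_summable_on_nat_iff')
  moreover have "suminf (pmf p) = 1"
    using infsetsum_nat'[OF s] infsetsum_pmf_eq_1[of p UNIV] by simp
  ultimately show ?thesis by (simp add: sums_iff)
qed

lemma distr_fun_eq_sum: "distr_fun \<nu> j = (\<Sum>k\<le>j. pmf \<nu> k)"
  by (simp add: measure_measure_pmf_finite)

lemma distr_fun_inject:
  assumes "\<And>j. distr_fun \<mu> j = distr_fun \<nu> j"
  shows "\<mu> = \<nu>"
proof (rule pmf_eqI)
  fix i show "pmf \<mu> i = pmf \<nu> i"
    using assms[of i] assms[of "i - 1"] unfolding distr_fun_eq_sum by (cases i) auto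
qed

lemma distr_fun_0:
  assumes "set_pmf \<nu> \<subseteq> {1..}"
  shows "distr_fun \<nu> 0 = 0"
proof -
  have "0 \<notin> set_pmf \<nu>" using assms by auto
  then show ?thesis by (simp add: measure_measure_pmf_finite set_pmf_iff)
qed

text \<open>The increments of \<open>q\<close> serve as point masses; their total telescopes to
  1.\<close>

lemma ex_pmf_distr_fun:
  fixes q :: "nat \<Rightarrow> real"
  assumes q0: "q 0 = 0" and "mono q" and lim: "q \<longlonglongrightarrow> 1"
  obtains \<nu> where "set_pmf \<nu> \<subseteq> {1..}" "\<And>j. distr_fun \<nu> j = q j"
proof -
  define f where "f = (\<lambda>j. if j = 0 then 0 else q j - q (j - 1))"
  have f: "f j \<ge> 0" for j using \<open>mono q\<close> by (simp add: f_def mono_def)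
  have "(\<lambda>n. f (Suc n)) sums 1" using telescope_sums[OF lim] by (simp add: f_def q0)
  then have "f sums 1" by (subst (asm) sums_Suc_iff) (simp add: f_def)
  then have "(\<Sum>n. ennreal (f n)) = 1" using f by (simp add: sums_iff suminf_ennreal2)
  then have total: "(\<integral>\<^sup>+ x. ennreal (f x) \<partial>count_space UNIV) = 1"
    by (simp add: nn_integral_count_space_nat)
  have pmf: "pmf (embed_pmf f) j = f j" for j using f total by (rule pmf_embed_pmf)
  show thesis
  proof
    show "set_pmf (embed_pmf f) \<subseteq> {1..}"
    proof
      fix j assume "j \<in> set_pmf (embed_pmf f)"
      then have "f j \<noteq> 0" by (simp add: set_pmf_iff pmf)
      then show "j \<in> {1..}" by (cases j) (simp_all add: f_def)
    qed
    show "distr_fun (embed_pmf f) j = q j" for j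
      unfolding distr_fun_eq_sum pmf by (induction j) (auto simp: f_def q0)
  qed
qed

section \<open>The generating function as an increasing homeomorphism of the unit interval, and the
  law of \<open>\<nu>\<close>\<close>

context
  fixes \<pi> assumes \<pi>: "\<pi> \<in> full_support_laws"
begin

lemma full_support_pmf_0: "pmf \<pi> 0 = 0"
  and full_support_pmf_pos: "n \<ge> 1 \<Longrightarrow> pmf \<pi> n > 0"
proof -
  have set: "set_pmf \<pi> = {1..}" using \<pi> by (simp add: full_support_laws_def)
  then show "pmf \<pi> 0 = 0" by (simp add: pmf_eq_0_set_pmf)
  show "pmf \<pi> n > 0" if "n \<ge> 1" using that by (intro pmf_positive) (simp add: set)
qed

lemma F_inf_eq: "F_inf \<pi> j = (\<Sum>k\<le>j. pmf \<pi> k)"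
proof -
  have "(\<Sum>k\<le>j. pmf \<pi> k) = (\<Sum>k=1..j. pmf \<pi> k)"
    by (rule sum.mono_neutral_right) (auto simp: not_less_eq_eq full_support_pmf_0)
  then show ?thesis by (simp add: F_inf_def)
qed

lemma Phi_inf_summable:
  assumes "z \<in> {0..1}"
  shows "summable (\<lambda>n. pmf \<pi> n * z ^ n)"
proof (rule summable_comparison_test'[OF sums_summable[OF pmf_nat_sums_1]])
  show "norm (pmf \<pi> n * z ^ n) \<le> pmf \<pi> n" for n
    using assms by (simp add: abs_mult power_le_one mult_left_le)
qed

text \<open>Indexing from 0 matches the formal series \<open>Abs_fps (pmf \<pi>)\<close>; splitting
  off the zero term uses convergence on \<open>[0, 1]\<close>.\<close>

lemma Phi_inf_eq:
  assumes "z \<in> {0..1}"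
  shows "Phi_inf \<pi> z = (\<Sum>n. pmf \<pi> n * z ^ n)"
  using suminf_split_head[OF Phi_inf_summable[OF assms]]
  by (simp add: Phi_inf_def full_support_pmf_0)

lemma Phi_inf_0: "Phi_inf \<pi> 0 = 0" and Phi_inf_1: "Phi_inf \<pi> 1 = 1"
proof -
  show "Phi_inf \<pi> 0 = 0" by (simp add: Phi_inf_def)
  show "Phi_inf \<pi> 1 = 1" using pmf_nat_sums_1[of \<pi>] by (simp add: Phi_inf_eq sums_iff)
qed

lemma strict_mono_Phi_inf: "strict_mono_on {0..1} (Phi_inf \<pi>)"
proof -
  have "strict_mono_on {0..1} (\<lambda>x. \<Sum>n. pmf \<pi> n * x ^ n)"
    using full_support_pmf_pos[of 1] pmf_nat_sums_1[of \<pi>]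
    by (intro powser_strict_mono_on) (auto simp: sums_iff)
  then show ?thesis
    by (auto simp: strict_mono_on_def Phi_inf_eq)
qed

lemma inj_on_Phi_inf: "inj_on (Phi_inf \<pi>) {0..1}"
  using strict_mono_Phi_inf by (rule strict_mono_on_imp_inj_on)

text \<open>The M-test with majorant \<open>pmf \<pi>\<close> gives continuity up to the endpoint
  1.\<close>

lemma continuous_on_Phi_inf: "continuous_on {0..1} (Phi_inf \<pi>)"
proof -
  have "uniform_limit {0..1} (\<lambda>n x. \<Sum>i<n. pmf \<pi> i * x ^ i) (\<lambda>x. \<Sum>i. pmf \<pi> i * x ^ i) sequentially"
    using sums_summable[OF pmf_nat_sums_1[of \<pi>]]
    by (intro Weierstrass_m_test[where M = "pmf \<pi>"]) (auto simp: abs_mult power_le_one mult_left_le)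
  then have "continuous_on {0..1} (\<lambda>x. \<Sum>i. pmf \<pi> i * x ^ i)"
    by (rule uniform_limit_theorem[rotated]) (auto intro!: always_eventually continuous_intros)
  then show ?thesis by (subst continuous_on_cong[OF refl Phi_inf_eq])
qed

lemma image_Phi_inf: "Phi_inf \<pi> ` {0..1} = {0..1}"
proof (intro equalityI subsetI)
  fix w assume "w \<in> Phi_inf \<pi> ` {0..1}"
  then obtain z where z: "z \<in> {0..1}" "w = Phi_inf \<pi> z" by blast
  have "Phi_inf \<pi> 0 \<le> Phi_inf \<pi> z" "Phi_inf \<pi> z \<le> Phi_inf \<pi> 1"
    using z by (auto intro!: strict_mono_on_leD[OF strict_mono_Phi_inf])
  then show "w \<in> {0..1}" using z Phi_inf_0 Phi_inf_1 by simp
next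
  fix w :: real assume "w \<in> {0..1}"
  then show "w \<in> Phi_inf \<pi> ` {0..1}"
    using IVT'[of "Phi_inf \<pi>" 0 w 1] continuous_on_Phi_inf Phi_inf_0 Phi_inf_1 by force
qed

lemma Phi_inf_inv_in: "w \<in> {0..1} \<Longrightarrow> Phi_inf_inv \<pi> w \<in> {0..1}"
  unfolding Phi_inf_inv_def by (rule inv_into_into) (simp add: image_Phi_inf)

lemma Phi_inf_Phi_inf_inv: "w \<in> {0..1} \<Longrightarrow> Phi_inf \<pi> (Phi_inf_inv \<pi> w) = w"
  unfolding Phi_inf_inv_def by (rule f_inv_into_f) (simp add: image_Phi_inf)

lemma Phi_inf_inv_Phi_inf: "z \<in> {0..1} \<Longrightarrow> Phi_inf_inv \<pi> (Phi_inf \<pi> z) = z"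
  unfolding Phi_inf_inv_def using inj_on_Phi_inf by (rule inv_into_f_f)

lemma Phi_inf_inv_0: "Phi_inf_inv \<pi> 0 = 0" and Phi_inf_inv_1: "Phi_inf_inv \<pi> 1 = 1"
  using Phi_inf_inv_Phi_inf[of 0] Phi_inf_inv_Phi_inf[of 1] by (simp_all add: Phi_inf_0 Phi_inf_1)

lemma strict_mono_Phi_inf_inv: "strict_mono_on {0..1} (Phi_inf_inv \<pi>)"
proof (rule strict_mono_onI, rule ccontr)
  fix v w :: real assume *: "v \<in> {0..1}" "w \<in> {0..1}" "v < w" "\<not> Phi_inf_inv \<pi> v < Phi_inf_inv \<pi> w"
  then have "Phi_inf \<pi> (Phi_inf_inv \<pi> w) \<le> Phi_inf \<pi> (Phi_inf_inv \<pi> v)"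
    by (intro strict_mono_on_leD[OF strict_mono_Phi_inf] Phi_inf_inv_in) auto
  then show False using * by (simp add: Phi_inf_Phi_inf_inv)
qed

text \<open>A continuous injection on a compact set has a continuous inverse on its image.\<close>

lemma continuous_on_Phi_inf_inv: "continuous_on {0..1} (Phi_inf_inv \<pi>)"
  using continuous_on_inv[OF continuous_on_Phi_inf] Phi_inf_inv_Phi_inf
  by (simp add: image_Phi_inf)

lemma F_inf_0: "F_inf \<pi> 0 = 0" by (simp add: F_inf_def)

lemma F_inf_less_Suc: "F_inf \<pi> j < F_inf \<pi> (Suc j)"
  using full_support_pmf_pos[of "Suc j"] by (simp add: F_inf_def)

lemma F_inf_LIMSEQ: "F_inf \<pi> \<longlonglongrightarrow> 1"
  using pmf_nat_sums_1[of \<pi>] unfolding sums_def_le F_inf_eq[abs_def] by simp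

text \<open>The value 1 is excluded because the next mass is positive; this keeps the inverse image
  below 1, as the inversion of the series requires.\<close>

lemma F_inf_in: "F_inf \<pi> j \<in> {0..<1}"
proof -
  have mono: "strict_mono (F_inf \<pi>)" by (rule strict_mono_Suc_iff[THEN iffD2]) (simp add: F_inf_less_Suc)
  have "F_inf \<pi> (Suc j) \<le> 1"
    using mono F_inf_LIMSEQ by (intro incseq_le) (auto simp: strict_mono_mono)
  then show ?thesis using F_inf_less_Suc[of j] F_inf_0 strict_mono_mono[OF mono, THEN monoD, of 0 j] by simp
qed

text \<open>The defining equation concerns \<open>j \<ge> 1\<close> only; at \<open>j = 0\<close>
  both sides are 0 because \<open>\<nu>\<close> has no mass there.\<close>

lemma is_nu_law_iff:
  "is_nu_law \<pi> \<nu> \<longleftrightarrow> set_pmf \<nu> \<subseteq> {1..} \<and> (\<forall>j. distr_fun \<nu> j = Phi_inf_inv \<pi> (F_inf \<pi> j))"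
proof
  assume *: "is_nu_law \<pi> \<nu>"
  have "distr_fun \<nu> j = Phi_inf_inv \<pi> (F_inf \<pi> j)" for j
  proof (cases "j = 0")
    case True
    then show ?thesis using * distr_fun_0[of \<nu>] by (simp add: is_nu_law_def F_inf_0 Phi_inf_inv_0)
  next
    case False
    then have "F_inf \<pi> j = Phi_inf \<pi> (distr_fun \<nu> j)" using * by (simp add: is_nu_law_def)
    then show ?thesis by (simp add: Phi_inf_inv_Phi_inf)
  qed
  then show "set_pmf \<nu> \<subseteq> {1..} \<and> (\<forall>j. distr_fun \<nu> j = Phi_inf_inv \<pi> (F_inf \<pi> j))"
    using * by (simp add: is_nu_law_def)
next
  assume "set_pmf \<nu> \<subseteq> {1..} \<and> (\<forall>j. distr_fun \<nu> j = Phi_inf_inv \<pi> (F_inf \<pi> j))"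
  then show "is_nu_law \<pi> \<nu>"
    using F_inf_in by (simp add: is_nu_law_def Phi_inf_Phi_inf_inv less_imp_le)
qed

text \<open>The function \<open>?q\<close> is nondecreasing, starts at 0 and, by continuity of the
  inverse at 1, tends to 1; so it is the distribution function of a law on the positive
  integers.\<close>

lemma ex1_nu_law: "\<exists>!\<nu>. is_nu_law \<pi> \<nu>"
proof -
  let ?q = "\<lambda>j. Phi_inf_inv \<pi> (F_inf \<pi> j)"
  have in01: "F_inf \<pi> j \<in> {0..1}" for j using F_inf_in[of j] by simp
  have "?q j \<le> ?q (Suc j)" for j
    using F_inf_less_Suc[of j] in01 by (intro strict_mono_on_leD[OF strict_mono_Phi_inf_inv]) simp_all
  then have mono: "mono ?q" by (rule mono_iff_le_Suc[THEN iffD2, rule_format])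
  have "(\<lambda>j. Phi_inf_inv \<pi> (F_inf \<pi> j)) \<longlonglongrightarrow> Phi_inf_inv \<pi> 1"
    using in01 by (intro continuous_on_tendsto_compose[OF continuous_on_Phi_inf_inv F_inf_LIMSEQ])
      (auto intro!: always_eventually)
  then obtain \<nu> where "set_pmf \<nu> \<subseteq> {1..}" "\<And>j. distr_fun \<nu> j = ?q j"
    using ex_pmf_distr_fun[of ?q] mono by (auto simp: F_inf_0 Phi_inf_inv_0 Phi_inf_inv_1)
  then have "is_nu_law \<pi> \<nu>" by (simp add: is_nu_law_iff)
  moreover have "\<mu> = \<nu>" if "is_nu_law \<pi> \<mu>" for \<mu>
    using that \<open>is_nu_law \<pi> \<nu>\<close> by (intro distr_fun_inject) (simp add: is_nu_law_iff)
  ultimately show ?thesis by blast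
qed

lemma is_nu_law_nu_law: "is_nu_law \<pi> (nu_law \<pi>)"
  unfolding nu_law_def by (rule theI') (rule ex1_nu_law)

lemma distr_fun_nu_law: "distr_fun (nu_law \<pi>) j = Phi_inf_inv \<pi> (F_inf \<pi> j)"
  using is_nu_law_nu_law by (simp add: is_nu_law_iff)

lemma Lagrange_term_eq:
  assumes "n \<ge> 1"
  shows "Lagrange_term \<pi> w n = fps_nth (fps_inv (Abs_fps (pmf \<pi>))) n * w ^ n"
  using fps_inv_pmf_nth[OF full_support_pmf_0 _ assms] full_support_pmf_pos[of 1]
  by (simp add: Lagrange_term_def power_divide)

text \<open>Strict monotonicity carries \<open>0 < w < 1\<close> over to \<open>0 < y < 1\<close>,
  where the inversion of the series applies; \<open>w = 0\<close> is treated apart.\<close>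

lemma summable_Lagrange_term_imp_sums:
  assumes w: "w \<in> {0..<1}" and s: "summable (\<lambda>n. Lagrange_term \<pi> w (Suc n))"
  shows "(\<lambda>n. Lagrange_term \<pi> w (Suc n)) sums Phi_inf_inv \<pi> w"
proof -
  define g where "g = fps_nth (fps_inv (Abs_fps (pmf \<pi>)))"
  define y where "y = Phi_inf_inv \<pi> w"
  have g0: "g 0 = 0" by (simp add: g_def fps_inv_def)
  have eq: "(\<lambda>n. Lagrange_term \<pi> w (Suc n)) = (\<lambda>n. g (Suc n) * w ^ Suc n)"
    using Lagrange_term_eq[of "Suc n" w for n] by (simp add: g_def fun_eq_iff)
  then have sg: "summable (\<lambda>n. g n * w ^ n)"
    using s summable_Suc_iff[of "\<lambda>n. g n * w ^ n"] by simp
  have "(\<Sum>n. g n * w ^ n) = y"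
  proof (cases "w = 0")
    case True
    then show ?thesis using powser_zero[of g] by (simp add: g0 y_def Phi_inf_inv_0)
  next
    case False
    have "Phi_inf_inv \<pi> 0 < y" "y < Phi_inf_inv \<pi> 1"
      unfolding y_def using False w by (auto intro!: strict_mono_onD[OF strict_mono_Phi_inf_inv])
    then have y: "0 < y" "y < 1" by (simp_all add: Phi_inf_inv_0 Phi_inf_inv_1)
    have "w = (\<Sum>n. pmf \<pi> n * y ^ n)"
      using Phi_inf_eq[of y] y w by (simp add: y_def Phi_inf_Phi_inf_inv)
    then show ?thesis
      using suminf_fps_inv_powser[of "pmf \<pi>" y w] full_support_pmf_0 full_support_pmf_pos[of 1]
        sums_summable[OF pmf_nat_sums_1] y sg by (simp add: g_def)
  qed
  then have "(\<lambda>n. g n * w ^ n) sums y" using sg by (simp add: sums_iff)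
  then have "(\<lambda>n. g (Suc n) * w ^ Suc n) sums y" by (subst sums_Suc_iff) (simp add: g0)
  then show ?thesis by (simp only: eq y_def)
qed

lemma ex_radius_Lagrange_term_sums:
  "\<exists>r>0. \<forall>w\<in>{0..<r}. (\<lambda>n. Lagrange_term \<pi> w (Suc n)) sums Phi_inf_inv \<pi> w"
proof -
  let ?f = "Abs_fps (pmf \<pi>)"
  have "fps_conv_radius ?f \<ge> norm (1::real)"
    unfolding fps_conv_radius_def using sums_summable[OF pmf_nat_sums_1]
    by (intro conv_radius_geI) simp
  then have "fps_conv_radius ?f > 0" by (auto intro: less_le_trans[of 0 1] simp: one_ereal_def)
  then have "fps_conv_radius (fps_inv ?f) > 0"
    using full_support_pmf_0 full_support_pmf_pos[of 1] by (intro fps_conv_radius_fps_inv_pos_real) auto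
  then obtain r where r: "0 < ereal r" "ereal r < fps_conv_radius (fps_inv ?f)"
    using ereal_dense2 by blast
  \<comment> \<open>The minimum with 1 keeps \<open>w\<close> in the domain where summability
    already identifies the sum.\<close>
  have "(\<lambda>n. Lagrange_term \<pi> w (Suc n)) sums Phi_inf_inv \<pi> w" if w: "w \<in> {0..<min r 1}" for w
  proof (rule summable_Lagrange_term_imp_sums)
    have "ereal (norm w) < ereal r" using w by simp
    also note r(2)
    finally have "summable (\<lambda>n. fps_nth (fps_inv ?f) n * w ^ n)" by (rule summable_fps)
    then have "summable (\<lambda>n. fps_nth (fps_inv ?f) (Suc n) * w ^ Suc n)" by (subst summable_Suc_iff)
    then show "summable (\<lambda>n. Lagrange_term \<pi> w (Suc n))"
      using Lagrange_term_eq[of "Suc n" w for n] by simp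
  qed (use w in simp)
  then show ?thesis using r by (intro exI[of _ "min r 1"]) simp
qed

end

section \<open>Uniqueness of the invariant probability and injectivity of the mapping\<close>

text \<open>With \<open>P i j = F j ^ i - F (j - 1) ^ i\<close>, the hypothesis says \<open>d = d P\<close>. If \<open>d\<close> took both signs,
  then the positive part \<open>e\<close> of \<open>d\<close> would satisfy \<open>e \<le> e P\<close> with strict inequality at \<open>1\<close>, so that
  summing over \<open>j\<close> gives \<open>\<Sum>e < \<Sum>e\<close>.\<close>

lemma invariant_same_sign:
  fixes d F :: "nat \<Rightarrow> real"
  assumes d0: "d 0 = 0" and d: "summable (\<lambda>n. \<bar>d n\<bar>)"
    and F0: "F 0 = 0" and F1: "F 1 > 0" and "mono F" and Fle: "\<And>j. F j \<le> 1"
    and inv: "\<And>j. (\<Sum>k\<le>j. d k) = (\<Sum>n. d n * F j ^ n)"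
    and neg: "d i < 0"
  shows "d k \<le> 0"
proof (rule ccontr)
  assume "\<not> d k \<le> 0"
  then have pos: "d k > 0" by simp
  define e where "e = (\<lambda>n. max (d n) 0)"
  \<comment> \<open>\<open>T j\<close> is the mass that \<open>e P\<close> gives to
    \<open>{1..j}\<close>, so \<open>T (Suc j) - T j\<close> is the entry of \<open>e P\<close> at
    \<open>Suc j\<close>.\<close>
  define T where "T = (\<lambda>j. \<Sum>n. e n * F j ^ n)"
  have e: "e n \<ge> 0" "d n \<le> e n" for n by (auto simp: e_def)
  have F01: "0 \<le> F j" "F j \<le> 1" "F j \<le> F (Suc j)" for j
    using \<open>mono F\<close> monoD[of F 0 j] monoD[of F j "Suc j"] F0 Fle by auto
  have sm: "summable (\<lambda>n. c n * F j ^ n)" if "summable (\<lambda>n. \<bar>c n\<bar>)" for c j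
  proof (rule summable_comparison_test'[OF that])
    show "norm (c n * F j ^ n) \<le> \<bar>c n\<bar>" for n
      using F01[of j] by (simp add: abs_mult power_le_one mult_left_le)
  qed
  have "summable (\<lambda>n. \<bar>e n\<bar>)"
    by (rule summable_comparison_test'[OF d]) (auto simp: e_def)
  then have se: "summable e" and sF: "summable (\<lambda>n. e n * F j ^ n)" "summable (\<lambda>n. d n * F j ^ n)" for j
    using e d by (auto intro: sm)
  have dF: "0 \<le> F (Suc j) ^ n - F j ^ n" for j n using F01[of j] by (simp add: power_mono)
  have T_diff: "T (Suc j) - T j = (\<Sum>n. e n * (F (Suc j) ^ n - F j ^ n))"
    and sT: "summable (\<lambda>n. e n * (F (Suc j) ^ n - F j ^ n))" for j
    unfolding T_def using suminf_diff[OF sF(1) sF(1)] summable_diff[OF sF(1) sF(1)]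
    by (simp_all add: algebra_simps)
  have d_Suc: "d (Suc j) = (\<Sum>n. d n * (F (Suc j) ^ n - F j ^ n))"
    and sd: "summable (\<lambda>n. d n * (F (Suc j) ^ n - F j ^ n))" for j
    using inv[of "Suc j"] inv[of j] suminf_diff[OF sF(2) sF(2), of "Suc j" j] summable_diff[OF sF(2) sF(2), of "Suc j" j]
    by (simp_all add: algebra_simps)
  have gap: "T (Suc j) - T j - d (Suc j) = (\<Sum>n. (e n - d n) * (F (Suc j) ^ n - F j ^ n))"
    and sgap: "summable (\<lambda>n. (e n - d n) * (F (Suc j) ^ n - F j ^ n))" for j
    unfolding T_diff d_Suc using suminf_diff[OF sT sd] summable_diff[OF sT sd] by (simp_all add: algebra_simps)
  \<comment> \<open>The entry of \<open>e P\<close> at \<open>Suc j\<close> is at least that of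
    \<open>d P = d\<close>, and at least 0, hence at least their maximum
    \<open>e (Suc j)\<close>.\<close>
  have step: "e (Suc j) \<le> T (Suc j) - T j" for j
  proof -
    have "0 \<le> T (Suc j) - T j - d (Suc j)"
      unfolding gap using e dF by (intro suminf_nonneg sgap mult_nonneg_nonneg) auto
    moreover have "0 \<le> T (Suc j) - T j"
      unfolding T_diff using e dF by (intro suminf_nonneg sT mult_nonneg_nonneg) auto
    ultimately show ?thesis by (simp add: e_def)
  qed
  \<comment> \<open>At state 1 both bounds are strict: the index \<open>i\<close> with
    \<open>d i < 0\<close> puts \<open>e P\<close> above \<open>d\<close>, and the index
    \<open>k\<close> with \<open>d k > 0\<close> puts it above 0.\<close>
  have "i \<noteq> 0" "k \<noteq> 0" using d0 neg pos by (metis less_irrefl)+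
  then have inc: "0 < F (Suc 0) ^ i - F 0 ^ i" "0 < F (Suc 0) ^ k - F 0 ^ k" using F1 by (simp_all add: F0 zero_power)
  have "0 < e i - d i" "0 < e k" using neg pos by (simp_all add: e_def)
  with inc have inc': "0 < (e i - d i) * (F (Suc 0) ^ i - F 0 ^ i)" "0 < e k * (F (Suc 0) ^ k - F 0 ^ k)"
    by (auto intro: mult_pos_pos)
  have "0 < T (Suc 0) - T 0 - d (Suc 0)"
    unfolding gap using e dF inc'(1)
    by (intro suminf_pos2[OF sgap, of _ i] mult_nonneg_nonneg) auto
  moreover have "0 < T (Suc 0) - T 0"
    unfolding T_diff using e dF inc'(2)
    by (intro suminf_pos2[OF sT, of _ k] mult_nonneg_nonneg) auto
  ultimately have strict: "0 < T (Suc 0) - T 0 - e (Suc 0)" by (simp add: e_def)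
  have T0: "T 0 = 0" unfolding T_def F0 using powser_zero[of e] d0 by (simp add: e_def)
  \<comment> \<open>Summing the steps keeps the strict gain made at 1; since \<open>T J\<close>
    never exceeds the sum of \<open>e\<close>, the limit in \<open>J\<close> is
    contradictory.\<close>
  have partial: "(\<Sum>n<Suc J. e (Suc n)) + (T (Suc 0) - T 0 - e (Suc 0)) \<le> T (Suc J)" for J
  proof (induction J)
    case 0
    then show ?case by (simp add: T0)
  next
    case (Suc J)
    then show ?case using step[of "Suc J"] by simp
  qed
  have "T J \<le> suminf e" for J
    unfolding T_def using e F01[of J] by (intro suminf_le sF se) (simp add: mult_left_le power_le_one)
  with partial have bound: "(\<Sum>n<Suc J. e (Suc n)) \<le> suminf e - (T (Suc 0) - T 0 - e (Suc 0))" for J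
    using order_trans by (metis le_diff_eq)
  have "e 0 = 0" by (simp add: e_def d0)
  then have "(\<lambda>n. e (Suc n)) sums suminf e" using se by (subst sums_Suc_iff) (simp add: summable_sums)
  then have "(\<lambda>J. \<Sum>n<Suc J. e (Suc n)) \<longlonglongrightarrow> suminf e"
    unfolding sums_def by (rule LIMSEQ_Suc)
  then have "suminf e \<le> suminf e - (T (Suc 0) - T 0 - e (Suc 0))"
    by (rule LIMSEQ_le_const2) (use bound in blast)
  with strict show False by simp
qed

text \<open>The difference \<open>d\<close> of the two laws is invariant for the same matrix and has
  sum 0. A negative entry would force all entries to be at most 0 and the sum to be negative; so
  \<open>d\<close> is nonnegative with sum 0, hence zero.\<close>

lemma nu_law_inject:
  assumes \<pi>: "\<pi> \<in> full_support_laws" and \<pi>': "\<pi>' \<in> full_support_laws"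
    and eq: "nu_law \<pi> = nu_law \<pi>'"
  shows "\<pi> = \<pi>'"
proof -
  define F where "F = distr_fun (nu_law \<pi>)"
  define d where "d = (\<lambda>n. pmf \<pi> n - pmf \<pi>' n)"
  have F01: "F j \<in> {0..1}" for j by (simp add: F_def)
  have law: "is_nu_law \<pi> (nu_law \<pi>)" "is_nu_law \<pi>' (nu_law \<pi>)"
    using is_nu_law_nu_law[OF \<pi>] is_nu_law_nu_law[OF \<pi>'] eq by simp_all
  have F0: "F 0 = 0" unfolding F_def using law(1) by (intro distr_fun_0) (simp add: is_nu_law_def)
  \<comment> \<open>This makes every transition to state 1 possible, which is the source of
    strictness in \<open>invariant_same_sign\<close>.\<close>
  have F1: "F 1 > 0"
  proof -
    have "Phi_inf_inv \<pi> (F_inf \<pi> 0) < Phi_inf_inv \<pi> (F_inf \<pi> 1)"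
      using F_inf_in[OF \<pi>, of 0] F_inf_in[OF \<pi>, of 1] F_inf_less_Suc[OF \<pi>, of 0]
      by (intro strict_mono_onD[OF strict_mono_Phi_inf_inv[OF \<pi>]]) auto
    then show ?thesis using F0 by (simp add: F_def distr_fun_nu_law[OF \<pi>])
  qed
  have mono: "mono F" unfolding F_def by (intro monoI measure_pmf.finite_measure_mono) auto
  have d0: "d 0 = 0" by (simp add: d_def full_support_pmf_0 \<pi> \<pi>')
  have s: "summable (pmf \<pi>)" "summable (pmf \<pi>')" using pmf_nat_sums_1 sums_summable by blast+
  have sd: "summable (\<lambda>n. \<bar>d n\<bar>)"
    by (rule summable_comparison_test'[OF summable_add[OF s]]) (auto simp: d_def abs_le_iff)
  then have sd': "summable d" by (rule summable_rabs_cancel)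
  have sum0: "(\<Sum>n. d n) = 0"
    using sums_diff[OF pmf_nat_sums_1 pmf_nat_sums_1, of \<pi> \<pi>'] by (simp add: d_def sums_iff)
  have F_inf_F: "F_inf \<rho> j = (\<Sum>n. pmf \<rho> n * F j ^ n)"
    if \<rho>: "\<rho> \<in> full_support_laws" and l: "is_nu_law \<rho> (nu_law \<pi>)" for \<rho> j
  proof -
    have "F_inf \<rho> j = Phi_inf \<rho> (F j)"
    proof (cases "j = 0")
      case True
      then show ?thesis by (simp add: F0 F_inf_def Phi_inf_0[OF \<rho>])
    next
      case False
      then show ?thesis using l by (simp add: is_nu_law_def F_def)
    qed
    then show ?thesis using Phi_inf_eq[OF \<rho> F01] by simp
  qed
  have inv: "(\<Sum>k\<le>j. d k) = (\<Sum>n. d n * F j ^ n)" for j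
  proof -
    have "(\<Sum>k\<le>j. d k) = F_inf \<pi> j - F_inf \<pi>' j"
      by (simp add: F_inf_eq \<pi> \<pi>' d_def sum_subtractf)
    also have "\<dots> = (\<Sum>n. pmf \<pi> n * F j ^ n - pmf \<pi>' n * F j ^ n)"
      unfolding F_inf_F[OF \<pi> law(1)] F_inf_F[OF \<pi>' law(2)]
      by (intro suminf_diff Phi_inf_summable \<pi> \<pi>' F01)
    finally show ?thesis by (simp add: d_def left_diff_distrib)
  qed
  have nonneg: "d i \<ge> 0" for i
  proof (rule ccontr)
    assume i: "\<not> d i \<ge> 0"
    have le: "- d k \<ge> 0" for k
      using invariant_same_sign[OF d0 sd F0 F1 mono _ inv, of i k] F01 i by simp
    have "0 < (\<Sum>n. - d n)"
      using le i by (intro suminf_pos2[OF summable_minus[OF sd'], of i]) auto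
    then show False using sum0 suminf_minus[OF sd'] by simp
  qed
  have "d i = 0" for i
    using suminf_eq_zero_iff[OF sd' nonneg] sum0 by simp
  then show ?thesis by (intro pmf_eqI) (simp add: d_def)
qed

text \<open>The coefficient identity and the expansion near 0 are unconditional. At
  \<open>F_inf \<pi> j\<close>, which may lie outside the disc of convergence, the series is equated
  with the distribution function whenever it is summable. The index \<open>Suc n\<close> starts the
  series at its first power.\<close>

theorem proposition2:
  shows "(\<forall>\<pi>\<in>full_support_laws. \<exists>!\<nu>. is_nu_law \<pi> \<nu>)
    \<and> inj_on nu_law full_support_laws
    \<and> (\<forall>\<pi>\<in>full_support_laws.
         (\<forall>n\<ge>1. fps_nth (fps_inv (Abs_fps (pmf \<pi>))) n = h_coeff \<pi> n / pmf \<pi> 1 ^ n)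
       \<and> (\<exists>r>0. \<forall>w\<in>{0..<r}. (\<lambda>n. Lagrange_term \<pi> w (Suc n)) sums Phi_inf_inv \<pi> w)
       \<and> (\<forall>j\<ge>1. distr_fun (nu_law \<pi>) j = Phi_inf_inv \<pi> (F_inf \<pi> j)
            \<and> (summable (\<lambda>n. Lagrange_term \<pi> (F_inf \<pi> j) (Suc n)) \<longrightarrow>
                 distr_fun (nu_law \<pi>) j = (\<Sum>n. Lagrange_term \<pi> (F_inf \<pi> j) (Suc n)))))"
proof (intro conjI ballI allI impI)
  fix \<pi> assume \<pi>: "\<pi> \<in> full_support_laws"
  show "\<exists>!\<nu>. is_nu_law \<pi> \<nu>" using \<pi> by (rule ex1_nu_law)
  show "fps_nth (fps_inv (Abs_fps (pmf \<pi>))) n = h_coeff \<pi> n / pmf \<pi> 1 ^ n" if "n \<ge> 1" for n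
    using full_support_pmf_0[OF \<pi>] full_support_pmf_pos[OF \<pi>, of 1] that
    by (intro fps_inv_pmf_nth) auto
  show "\<exists>r>0. \<forall>w\<in>{0..<r}. (\<lambda>n. Lagrange_term \<pi> w (Suc n)) sums Phi_inf_inv \<pi> w"
    using \<pi> by (rule ex_radius_Lagrange_term_sums)
  fix j :: nat
  show F: "distr_fun (nu_law \<pi>) j = Phi_inf_inv \<pi> (F_inf \<pi> j)"
    using \<pi> by (rule distr_fun_nu_law)
  assume "summable (\<lambda>n. Lagrange_term \<pi> (F_inf \<pi> j) (Suc n))"
  then show "distr_fun (nu_law \<pi>) j = (\<Sum>n. Lagrange_term \<pi> (F_inf \<pi> j) (Suc n))"
    using summable_Lagrange_term_imp_sums[OF \<pi> F_inf_in[OF \<pi>]] by (simp add: F sums_iff)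
next
  show "inj_on nu_law full_support_laws"
    by (rule inj_onI, rule nu_law_inject)
qed

end
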